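(* For any graph $G$ of order $n$ and any integer $t\ge 2$, $$\gamma(S(G,t))\le n^{t-2}\bigl(n\gamma(G)-\xi(G)\bigr).$$
   Context: A set $D\subseteq V$ is dominating in $G=(V,E)$ if every vertex of $V\setminus D$ has a neighbour in $D$; the domination number $\gamma(G)$ is the minimum cardinality of a dominating set, and a dominating set of cardinality $\gamma(G)$ is a $\gamma(G)$-set. Let $\mathcal D(G)$ be the set of all $\gamma(G)$-sets. Define $\xi(G)=\max_{D\in\mathcal D(G)}\{|D'|:\ D'\subseteq D \text{ and the subgraph } \langle D'\rangle \text{ induced by } D' \text{ has no isolated vertices}\}$ (the empty set is allowed, so $0\le \xi(G)\le\gamma(G)$). For a positive integer $t$, $V^t$ denotes the set of words $u=u_1\cdots u_t$ of length $t$ over $V$. The generalized Sierpiński graph $S(G,t)$ has vertex set $V^t$, and $\{u,v\}$ is an edge if and only if there is $i\in\{1,\dots,t\}$ such that: (i) $u_j=v_j$ for all $j<i$; (ii) $u_i\ne v_i$ and $\{u_i,v_i\}\in E$; (iii) $u_j=v_i$ and $v_j=u_i$ for all $j>i$. *)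

theory Defs
  imports Complex_Main "Graph_Theory.Graph_Theory"
begin

text \<open>
  Finite simple undirected graphs are modelled by the locale \<^locale>\<open>pair_graph\<close>: a finite vertex
  set with a symmetric irreflexive arc relation, the edge \<open>{u,v}\<close> being represented by the
  two arcs \<open>(u,v)\<close> and \<open>(v,u)\<close>.
\<close>

definition dominating_set :: "('a,'b) pre_digraph \<Rightarrow> 'a set \<Rightarrow> bool" where
  "dominating_set G D \<longleftrightarrow>
     D \<subseteq> verts G \<and> (\<forall>v \<in> verts G - D. \<exists>d \<in> D. v \<rightarrow>\<^bsub>G\<^esub> d)"

definition domination_number :: "('a,'b) pre_digraph \<Rightarrow> nat" where
  "domination_number G = Min {card D | D. dominating_set G D}"

definition gamma_sets :: "('a,'b) pre_digraph \<Rightarrow> 'a set set" where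
  "gamma_sets G = {D. dominating_set G D \<and> card D = domination_number G}"

definition isolated_vertex :: "('a,'b) pre_digraph \<Rightarrow> 'a \<Rightarrow> bool" where
  "isolated_vertex H v \<longleftrightarrow> v \<in> verts H \<and> \<not> (\<exists>w \<in> verts H. v \<rightarrow>\<^bsub>H\<^esub> w)"

definition xi :: "('a,'b) pre_digraph \<Rightarrow> nat" where
  "xi G = Max {card D' | D D'. D \<in> gamma_sets G \<and> D' \<subseteq> D \<and>
                               \<not> (\<exists>v. isolated_vertex (G \<restriction> D') v)}"

text \<open>Words are lists, so letter positions are counted from \<open>0\<close> instead of \<open>1\<close>.\<close>

definition words :: "'a set \<Rightarrow> nat \<Rightarrow> 'a list set" where
  "words V t = {u. set u \<subseteq> V \<and> length u = t}"

definition sierpinski :: "'a pair_pre_digraph \<Rightarrow> nat \<Rightarrow> 'a list pair_pre_digraph" where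
  "sierpinski G t =
     \<lparr> pverts = words (pverts G) t,
       parcs = {(u, v). u \<in> words (pverts G) t \<and> v \<in> words (pverts G) t \<and>
                 (\<exists>i<t. (\<forall>j<i. u ! j = v ! j) \<and>
                        u ! i \<noteq> v ! i \<and> (u ! i, v ! i) \<in> parcs G \<and>
                        (\<forall>j. i < j \<and> j < t \<longrightarrow> u ! j = v ! i \<and> v ! j = u ! i))} \<rparr>"

lemma pair_graph_sierpinski:
  assumes "pair_graph G"
  shows "pair_graph (sierpinski G t)"
proof -
  interpret pair_graph G by fact
  have fin: "finite (words (pverts G) t)"
    unfolding words_def using pair_finite_verts by (rule finite_lists_length_eq)
  have fin_arcs: "finite (parcs (sierpinski G t))"
    by (rule finite_subset[OF _ finite_cartesian_product[OF fin fin]])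
       (unfold sierpinski_def pair_pre_digraph.select_convs, blast)
  have sym: "(a, b) \<in> parcs G \<Longrightarrow> (b, a) \<in> parcs G" for a b
    using pair_sym_arcs by (auto simp: symmetric_def dest: symD)
  have "sym (parcs (sierpinski G t))"
  proof (rule symI)
    fix u v assume "(u, v) \<in> parcs (sierpinski G t)"
    then obtain i where uv: "u \<in> words (pverts G) t" "v \<in> words (pverts G) t"
      and i: "i < t" "\<forall>j<i. u ! j = v ! j" "u ! i \<noteq> v ! i" "(u ! i, v ! i) \<in> parcs G"
        "\<forall>j. i < j \<and> j < t \<longrightarrow> u ! j = v ! i \<and> v ! j = u ! i"
      unfolding sierpinski_def pair_pre_digraph.select_convs mem_Collect_eq case_prod_conv
      by blast
    have "\<exists>i<t. (\<forall>j<i. v ! j = u ! j) \<and> v ! i \<noteq> u ! i \<and> (v ! i, u ! i) \<in> parcs G \<and>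
        (\<forall>j. i < j \<and> j < t \<longrightarrow> v ! j = u ! i \<and> u ! j = v ! i)"
    proof (intro exI[of _ i] conjI)
      show "v ! i \<noteq> u ! i" using i(3) by (rule not_sym)
      show "\<forall>j. i < j \<and> j < t \<longrightarrow> v ! j = u ! i \<and> u ! j = v ! i" using i(5) by blast
      show "\<forall>j<i. v ! j = u ! j" using i(2) by metis
    qed (rule i(1), rule sym[OF i(4)])
    with uv show "(v, u) \<in> parcs (sierpinski G t)"
      unfolding sierpinski_def pair_pre_digraph.select_convs mem_Collect_eq case_prod_conv
      by blast
  qed
  moreover have "fst e \<in> pverts (sierpinski G t) \<and> snd e \<in> pverts (sierpinski G t)"
      and "fst e \<noteq> snd e" if "e \<in> parcs (sierpinski G t)" for e
    using that unfolding sierpinski_def pair_pre_digraph.select_convs 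
      mem_Collect_eq case_prod_unfold by (blast, metis)
  moreover have "finite (pverts (sierpinski G t))"
    using fin by (simp add: sierpinski_def)
  ultimately show ?thesis
    using fin_arcs by unfold_locales (blast | simp add: symmetric_def)+
qed

text \<open>The sets under \<^const>\<open>Min\<close> and \<^const>\<open>Max\<close> above are finite and nonempty for finite graphs.\<close>

lemma dominating_set_cards:
  assumes "finite (verts G)"
  shows "finite {card D | D. dominating_set G D}" "{card D | D. dominating_set G D} \<noteq> {}"
proof -
  have "{card D | D. dominating_set G D} \<subseteq> card ` Pow (verts G)"
    by (auto simp: dominating_set_def)
  then show "finite {card D | D. dominating_set G D}"
    using assms by (simp add: finite_subset[OF _ finite_imageI])
  have "dominating_set G (verts G)" by (auto simp: dominating_set_def)
  then show "{card D | D. dominating_set G D} \<noteq> {}" by blast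
qed

lemma gamma_sets_nonempty:
  assumes "finite (verts G)"
  shows "gamma_sets G \<noteq> {}"
  using Min_in[OF dominating_set_cards[OF assms]]
  by (auto simp: gamma_sets_def domination_number_def)

lemma xi_cards:
  fixes G :: "('a,'b) pre_digraph"
  assumes "finite (verts G)"
  defines "S \<equiv> {card D' | D D'. D \<in> gamma_sets G \<and> D' \<subseteq> D \<and>
                               \<not> (\<exists>v. isolated_vertex (G \<restriction> D') v)}"
  shows "finite S" "S \<noteq> {}"
proof -
  have "S \<subseteq> card ` Pow (verts G)"
    unfolding S_def by (auto simp: gamma_sets_def dominating_set_def)
  then show "finite S"
    using assms(1) by (simp add: finite_subset[OF _ finite_imageI])
  obtain D where "D \<in> gamma_sets G"
    using gamma_sets_nonempty[OF assms(1)] by blast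
  moreover have "\<not> (\<exists>v. isolated_vertex (G \<restriction> {}) v)"
    by (simp add: isolated_vertex_def)
  ultimately show "S \<noteq> {}" unfolding S_def by blast
qed

end

theory Submission
  imports Defs
begin

text \<open>
  Let \<open>D\<close> be a \<open>\<gamma>(G)\<close>-set and \<open>D' \<subseteq> D\<close> induce a subgraph without isolated vertices. The words
  \<open>wxy\<close> with \<open>y \<in> D\<close> dominate \<open>S(G,t)\<close>, and they still do after deletion of the words \<open>wxx\<close>
  with \<open>x \<in> D'\<close>: such a word is dominated by \<open>wxz\<close> for a neighbour \<open>z \<in> D'\<close> of \<open>x\<close>, and a word
  \<open>wxy\<close> with \<open>y \<notin> D\<close> whose dominating word \<open>wxx\<close> has been deleted is dominated by \<open>wyx\<close>.
\<close>

lemma domination_number_le: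
  assumes "finite (verts G)" and "dominating_set G D"
  shows "domination_number G \<le> card D"
  unfolding domination_number_def
  using dominating_set_cards(1)[OF assms(1)] assms(2) by (intro Min_le) auto

text \<open>The maximum defining \<open>xi\<close> is attained because its set of candidates is
  finite and nonempty. As the vertices of the subgraph induced by \<open>D'\<close> are exactly
  \<open>D'\<close>, having no isolated vertex there means that each element of \<open>D'\<close>
  has a neighbour inside \<open>D'\<close>.\<close>

lemma xi_witness:
  assumes "finite (verts G)"
  obtains D D' where "dominating_set G D" "card D = domination_number G" "D' \<subseteq> D"
    "card D' = xi G" "\<And>x. x \<in> D' \<Longrightarrow> \<exists>z \<in> D'. x \<rightarrow>\<^bsub>G\<^esub> z"
proof -
  from Max_in[OF xi_cards[OF assms]] obtain D D'
    where D: "D \<in> gamma_sets G" "D' \<subseteq> D" "card D' = xi G"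
      and isol: "\<not> (\<exists>v. isolated_vertex (G \<restriction> D') v)"
    unfolding xi_def[symmetric] by auto
  have "\<exists>z \<in> D'. x \<rightarrow>\<^bsub>G\<^esub> z" if "x \<in> D'" for x
    using isol that by (force simp: isolated_vertex_def arcs_ends_def arc_to_ends_def)
  then show thesis
    using that D by (auto simp: gamma_sets_def)
qed

text \<open>The words first differ at their last position \<open>Suc m\<close>, so the condition on
  later letters is vacuous.\<close>

lemma sierpinski_arc_last:
  assumes "w \<in> words (pverts G) m" "x \<in> pverts G" "y \<in> pverts G" "z \<in> pverts G"
    and "(y, z) \<in> parcs G" "y \<noteq> z"
  shows "(w @ [x, y], w @ [x, z]) \<in> parcs (sierpinski G (Suc (Suc m)))"
  using assms
  by (auto simp: sierpinski_def words_def nth_append nth_Cons' intro!: exI[of _ "Suc m"])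

text \<open>The words first differ at position \<open>m\<close>; the only later position is
  \<open>Suc m\<close>, where the swapped letters are exactly what the edge condition
  demands.\<close>

lemma sierpinski_arc_swap:
  assumes "w \<in> words (pverts G) m" "x \<in> pverts G" "y \<in> pverts G"
    and "(x, y) \<in> parcs G" "x \<noteq> y"
  shows "(w @ [x, y], w @ [y, x]) \<in> parcs (sierpinski G (Suc (Suc m)))"
  using assms
  by (auto simp: sierpinski_def words_def nth_append nth_Cons' intro!: exI[of _ m])

lemma words_Suc_Suc_cases:
  assumes "u \<in> words V (Suc (Suc m))"
  obtains w x y where "u = w @ [x, y]" "w \<in> words V m" "x \<in> V" "y \<in> V"
proof -
  from assms have len: "length u = Suc (Suc m)" and sub: "set u \<subseteq> V"
    by (auto simp: words_def)
  from len obtain v y where v: "u = v @ [y]" "length v = Suc m"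
    by (metis length_Suc_conv_rev)
  from v(2) obtain w x where w: "v = w @ [x]" "length w = m"
    by (metis length_Suc_conv_rev)
  show thesis
    using that[of w x y] v w sub by (auto simp: words_def)
qed

text \<open>Writing the set as an image of a product, with a diagonal copy of \<open>D'\<close>
  removed from the second factor, lets its cardinality be read off later.\<close>

lemma dominating_set_sierpinski:
  assumes "pair_graph G" and dom: "dominating_set (with_proj G) D" and "D' \<subseteq> D"
    and nbr: "\<And>x. x \<in> D' \<Longrightarrow> \<exists>z \<in> D'. (x, z) \<in> parcs G"
  shows "dominating_set (with_proj (sierpinski G (Suc (Suc m))))
    ((\<lambda>(w, x, y). w @ [x, y]) ` (words (pverts G) m \<times> (pverts G \<times> D - (\<lambda>x. (x, x)) ` D')))"
    (is "dominating_set _ ?S")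
proof -
  interpret pair_graph G by fact
  have DV: "D \<subseteq> pverts G"
    and dominated: "\<And>v. v \<in> pverts G \<Longrightarrow> v \<notin> D \<Longrightarrow> \<exists>d \<in> D. (v, d) \<in> parcs G"
    using dom by (auto simp: dominating_set_def)
  have sym: "(a, b) \<in> parcs G \<Longrightarrow> (b, a) \<in> parcs G" for a b
    using pair_sym_arcs by (auto simp: symmetric_def dest: symD)
  have neq: "(a, b) \<in> parcs G \<Longrightarrow> a \<noteq> b" for a b
    using pair_no_loops[of "(a, b)"] by auto
  have memI: "w @ [x, y] \<in> ?S"
    if "w \<in> words (pverts G) m" "x \<in> pverts G" "y \<in> D" "x \<noteq> y \<or> x \<notin> D'" for w x y
    using that by force
  have "\<exists>d \<in> ?S. (u, d) \<in> parcs (sierpinski G (Suc (Suc m)))"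
    if u: "u \<in> words (pverts G) (Suc (Suc m))" and "u \<notin> ?S" for u
  proof -
    from u obtain w x y where wxy: "u = w @ [x, y]" "w \<in> words (pverts G) m"
      "x \<in> pverts G" "y \<in> pverts G"
      by (rule words_Suc_Suc_cases)
    show ?thesis
    proof (cases "y \<in> D")
      case True
      \<comment> \<open>With \<open>y\<close> in \<open>D\<close>, the only way to be outside the
        set is to be a deleted word.\<close>
      with \<open>u \<notin> ?S\<close> wxy memI have xy: "x = y" "x \<in> D'" by blast+
      with nbr obtain z where z: "z \<in> D'" "(x, z) \<in> parcs G" by blast
      show ?thesis
      proof
        show "w @ [x, z] \<in> ?S" using wxy z \<open>D' \<subseteq> D\<close> neq by (intro memI) auto
        show "(u, w @ [x, z]) \<in> parcs (sierpinski G (Suc (Suc m)))"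
          using wxy xy z \<open>D' \<subseteq> D\<close> DV neq by (auto intro!: sierpinski_arc_last)
      qed
    next
      case False
      with dominated wxy obtain d where d: "d \<in> D" "(y, d) \<in> parcs G" by blast
      show ?thesis
      \<comment> \<open>The natural dominator \<open>w @ [x, d]\<close> is missing precisely in this
        case.\<close>
      proof (cases "x = d \<and> x \<in> D'")
        case True
        show ?thesis
        proof
          \<comment> \<open>The last letter \<open>x\<close> equals \<open>d\<close>, so it lies in
            \<open>D\<close>; the absence of loops gives \<open>y \<noteq> x\<close>, so this word
            was not deleted.\<close>
          show "w @ [y, x] \<in> ?S" using wxy True d neq by (intro memI) auto
          show "(u, w @ [y, x]) \<in> parcs (sierpinski G (Suc (Suc m)))"
            using wxy True d neq sym by (auto intro!: sierpinski_arc_swap)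
        qed
      next
        case False
        show ?thesis
        proof
          show "w @ [x, d] \<in> ?S" using wxy False d by (intro memI) auto
          show "(u, w @ [x, d]) \<in> parcs (sierpinski G (Suc (Suc m)))"
            using wxy d DV neq by (auto intro!: sierpinski_arc_last)
        qed
      qed
    qed
  qed
  moreover have "?S \<subseteq> words (pverts G) (Suc (Suc m))"
    using DV by (auto simp: words_def)
  moreover have "pverts (sierpinski G (Suc (Suc m))) = words (pverts G) (Suc (Suc m))"
    by (simp add: sierpinski_def)
  ultimately show ?thesis
    by (simp add: dominating_set_def)
qed

theorem theorem11:
  fixes G :: "'a pair_pre_digraph" and n t :: nat
  assumes "pair_graph G"
    and "card (pverts G) = n"
    and "t \<ge> 2"
  shows "int (domination_number (with_proj (sierpinski G t)))
           \<le> int n ^ (t - 2) *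
             (int n * int (domination_number (with_proj G)) - int (xi (with_proj G)))"
proof -
  interpret pair_graph G by fact
  interpret S: pair_graph "sierpinski G t"
    using assms(1) by (rule pair_graph_sierpinski)
  define m where "m = t - 2"
  have t: "t = Suc (Suc m)" using assms(3) by (simp add: m_def)
  obtain D D' where D: "dominating_set (with_proj G) D"
    "card D = domination_number (with_proj G)" "D' \<subseteq> D" "card D' = xi (with_proj G)"
    and nbr: "\<And>x. x \<in> D' \<Longrightarrow> \<exists>z \<in> D'. x \<rightarrow>\<^bsub>with_proj G\<^esub> z"
    using xi_witness[of "with_proj G"] by auto
  have DV: "D \<subseteq> pverts G" using D(1) by (simp add: dominating_set_def)
  have fin: "finite D" "finite D'"
    using DV D(3) finite_subset pair_finite_verts by metis+
  let ?P = "pverts G \<times> D - (\<lambda>x. (x, x)) ` D'"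
  let ?f = "\<lambda>(w, x, y). w @ [x, y :: 'a]"
  have diag: "(\<lambda>x. (x, x)) ` D' \<subseteq> pverts G \<times> D" using D(3) DV by auto
  have card_diag: "card ((\<lambda>x. (x, x)) ` D') = card D'"
    by (rule card_image) (auto simp: inj_on_def)
  have "card ?P = n * card D - card D'"
    using fin diag card_diag assms(2) by (simp add: card_Diff_subset card_cartesian_product)
  \<comment> \<open>This bound rules out truncation in the natural-number subtraction above, so the
    count carries over to the integers.\<close>
  moreover have "card D' \<le> n * card D"
    using card_mono[OF _ diag] fin card_diag assms(2) by (simp add: card_cartesian_product)
  ultimately have card_P: "int (card ?P) = int n * int (card D) - int (card D')"
    by (simp add: of_nat_diff)
  have "domination_number (with_proj (sierpinski G t)) \<le> card (?f ` (words (pverts G) m \<times> ?P))"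
    unfolding t using S.pair_finite_verts t nbr
    by (intro domination_number_le dominating_set_sierpinski assms(1) D) auto
  also have "\<dots> = card (words (pverts G) m \<times> ?P)"
    \<comment> \<open>The last two letters and the remaining prefix can be recovered from the
      word.\<close>
    by (rule card_image) (auto simp: inj_on_def)
  also have "\<dots> = n ^ m * card ?P"
    using card_lists_length_eq[OF pair_finite_verts] assms(2)
    by (simp add: card_cartesian_product words_def)
  finally have "int (domination_number (with_proj (sierpinski G t))) \<le> int (n ^ m * card ?P)"
    by (rule of_nat_mono)
  then show ?thesis
    using card_P D by (simp add: m_def)
qed

end
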